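(* Let $(X,\cdot,\ast)$ be a P{\l}onka bi-magma and consider $R=R_{(\cdot,\ast)}$ to be the associated canonical YB-solution. Then: (1) $R$ is ideal-simple if and only if there exists an incompressible pair $\{f,g\}$ of commuting maps $f,g:X\to X$ such that $R=R_{(f,g)}$, i.e. $R(x,y)=(f(x),g(y))$ for all $x,y\in X$. (2) The set of isomorphism classes of all ideal-simple YB-solutions $R$ on $X$ is parameterized by the set of all triples $(m,n,d)\in\mathbb{Z}_{\ge 0}\times\mathbb{Z}_{>0}^2$, where $d\le|\mathbb{Z}/m|$. (3) If $X$ is a finite set with $|X|=t$, then the number of isomorphism classes of all ideal-simple YB-solutions $R$ on $X$ is $\sigma(t)$, the sum of all divisors of $t$.
   Context: A bi-magma $(X,\cdot,\ast)$ is a set with two binary operations. A P{\l}onka bi-magma is a bi-magma such that for all $x,y,z\in X$: - $(x\cdot y)\cdot z=(x\cdot z)\cdot y$ and $x\cdot(y\cdot z)=x\cdot y$; - $x\ast(y\ast z)=y\ast(x\ast z)$ and $(x\ast y)\ast z=y\ast z$; - $x\ast(y\cdot z)=(x\ast y)\cdot z$, $\ (x\cdot z)\ast y=x\ast y$, $\ x\cdot(y\ast z)=x\cdot z$. A map $R:X\times X\to X\times X$ is a YB-solution if $R^{12}R^{13}R^{23}=R^{23}R^{13}R^{12}$ on $X^3$, where $R^{ij}$ acts as $R$ on coordinates $i,j$ and as the identity on the remaining one. For every P{\l}onka bi-magma, the map $R_{(\cdot,\ast)}:X\times X\to X\times X$, $R_{(\cdot,\ast)}(x,y)=(x\cdot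 y,x\ast y)$, is a YB-solution, called the canonical YB-solution associated to the bi-magma. Two solutions $(X,R)$, $(X',R')$ are isomorphic if there is a bijection $\sigma:X\to X'$ with $(\sigma\times\sigma)\circ R=R'\circ(\sigma\times\sigma)$. A non-empty subset $I\subseteq X$ is an ideal of $R$ if $R(I\times X)\subseteq I\times X$ and $R(X\times I)\subseteq X\times I$. $R$ is ideal-simple if $X$ is the only ideal of $R$. A family $\mathcal{F}$ of maps $X\to X$ is incompressible if there is no non-empty proper subset $I\subsetneq X$ with $f(I)\subseteq I$ for all $f\in\mathcal{F}$. Here $\mathbb{Z}/m=\mathbb{Z}$ when $m=0$. *)

theory Defs
  imports Main "HOL-Library.FuncSet"
begin

locale plonka_bimagma =
  fixes X :: "'a set"
    and dot :: "'a \<Rightarrow> 'a \<Rightarrow> 'a" (infixl "\<cdot>" 70)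
    and ast :: "'a \<Rightarrow> 'a \<Rightarrow> 'a" (infixl "\<star>" 70)
  assumes dot_closed: "x \<in> X \<Longrightarrow> y \<in> X \<Longrightarrow> x \<cdot> y \<in> X"
    and ast_closed: "x \<in> X \<Longrightarrow> y \<in> X \<Longrightarrow> x \<star> y \<in> X"
    and dot_right_comm: "x \<in> X \<Longrightarrow> y \<in> X \<Longrightarrow> z \<in> X \<Longrightarrow> (x \<cdot> y) \<cdot> z = (x \<cdot> z) \<cdot> y"
    and dot_absorb: "x \<in> X \<Longrightarrow> y \<in> X \<Longrightarrow> z \<in> X \<Longrightarrow> x \<cdot> (y \<cdot> z) = x \<cdot> y"
    and ast_left_comm: "x \<in> X \<Longrightarrow> y \<in> X \<Longrightarrow> z \<in> X \<Longrightarrow> x \<star> (y \<star> z) = y \<star> (x \<star> z)"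
    and ast_absorb: "x \<in> X \<Longrightarrow> y \<in> X \<Longrightarrow> z \<in> X \<Longrightarrow> (x \<star> y) \<star> z = y \<star> z"
    and ast_dot: "x \<in> X \<Longrightarrow> y \<in> X \<Longrightarrow> z \<in> X \<Longrightarrow> x \<star> (y \<cdot> z) = (x \<star> y) \<cdot> z"
    and dot_ast_absorb: "x \<in> X \<Longrightarrow> y \<in> X \<Longrightarrow> z \<in> X \<Longrightarrow> (x \<cdot> z) \<star> y = x \<star> y"
    and ast_dot_absorb: "x \<in> X \<Longrightarrow> y \<in> X \<Longrightarrow> z \<in> X \<Longrightarrow> x \<cdot> (y \<star> z) = x \<cdot> z"

definition canonical_map :: "('a \<Rightarrow> 'a \<Rightarrow> 'a) \<Rightarrow> ('a \<Rightarrow> 'a \<Rightarrow> 'a) \<Rightarrow> 'a \<times> 'a \<Rightarrow> 'a \<times> 'a" where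
  "canonical_map dot ast = (\<lambda>(x, y). (dot x y, ast x y))"

definition R12 :: "('a \<times> 'a \<Rightarrow> 'a \<times> 'a) \<Rightarrow> 'a \<times> 'a \<times> 'a \<Rightarrow> 'a \<times> 'a \<times> 'a" where
  "R12 R = (\<lambda>(x, y, z). (fst (R (x, y)), snd (R (x, y)), z))"

definition R13 :: "('a \<times> 'a \<Rightarrow> 'a \<times> 'a) \<Rightarrow> 'a \<times> 'a \<times> 'a \<Rightarrow> 'a \<times> 'a \<times> 'a" where
  "R13 R = (\<lambda>(x, y, z). (fst (R (x, z)), y, snd (R (x, z))))"

definition R23 :: "('a \<times> 'a \<Rightarrow> 'a \<times> 'a) \<Rightarrow> 'a \<times> 'a \<times> 'a \<Rightarrow> 'a \<times> 'a \<times> 'a" where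
  "R23 R = (\<lambda>(x, y, z). (x, fst (R (y, z)), snd (R (y, z))))"

definition YB_solution :: "'a set \<Rightarrow> ('a \<times> 'a \<Rightarrow> 'a \<times> 'a) \<Rightarrow> bool" where
  "YB_solution X R \<longleftrightarrow> R \<in> X \<times> X \<rightarrow> X \<times> X \<and>
     (\<forall>t \<in> X \<times> X \<times> X. (R12 R \<circ> R13 R \<circ> R23 R) t = (R23 R \<circ> R13 R \<circ> R12 R) t)"

lemma (in plonka_bimagma) canonical_map_YB_solution:
  "YB_solution X (canonical_map dot ast)"
  by (auto simp: YB_solution_def canonical_map_def R12_def R13_def R23_def dot_closed ast_closed
      dot_right_comm dot_absorb ast_left_comm ast_absorb ast_dot dot_ast_absorb ast_dot_absorb)

definition is_ideal :: "'a set \<Rightarrow> ('a \<times> 'a \<Rightarrow> 'a \<times> 'a) \<Rightarrow> 'a set \<Rightarrow> bool" where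
  "is_ideal X R I \<longleftrightarrow> I \<noteq> {} \<and> I \<subseteq> X \<and> R ` (I \<times> X) \<subseteq> I \<times> X \<and> R ` (X \<times> I) \<subseteq> X \<times> I"

definition ideal_simple :: "'a set \<Rightarrow> ('a \<times> 'a \<Rightarrow> 'a \<times> 'a) \<Rightarrow> bool" where
  "ideal_simple X R \<longleftrightarrow> {I. is_ideal X R I} = {X}"

definition incompressible :: "'a set \<Rightarrow> ('a \<Rightarrow> 'a) set \<Rightarrow> bool" where
  "incompressible X F \<longleftrightarrow> \<not> (\<exists>I. I \<noteq> {} \<and> I \<subset> X \<and> (\<forall>f \<in> F. f ` I \<subseteq> I))"

definition prod_map :: "('a \<Rightarrow> 'a) \<Rightarrow> ('a \<Rightarrow> 'a) \<Rightarrow> 'a \<times> 'a \<Rightarrow> 'a \<times> 'a" where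
  "prod_map f g = (\<lambda>(x, y). (f x, g y))"

text \<open>Values of \<open>R\<close> outside \<open>X \<times> X\<close> are irrelevant to the pair \<open>(X, R)\<close>; pairs that differ only
  there are isomorphic via the identity, hence define the same isomorphism class.\<close>

type_synonym 'a solution = "'a set \<times> ('a \<times> 'a \<Rightarrow> 'a \<times> 'a)"

definition isomorphic :: "'a solution \<Rightarrow> 'b solution \<Rightarrow> bool" where
  "isomorphic S S' \<longleftrightarrow> (\<exists>\<sigma>. bij_betw \<sigma> (fst S) (fst S') \<and>
     (\<forall>p \<in> fst S \<times> fst S. map_prod \<sigma> \<sigma> (snd S p) = snd S' (map_prod \<sigma> \<sigma> p)))"

definition iso_classes :: "'a solution set \<Rightarrow> 'a solution set set" where
  "iso_classes A = A // {(S, S'). S \<in> A \<and> S' \<in> A \<and> isomorphic S S'}"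

definition simple_canonical_solutions :: "'a solution set" where
  "simple_canonical_solutions = {(X, R). YB_solution X R \<and> ideal_simple X R \<and>
     (\<exists>dot ast. plonka_bimagma X dot ast \<and> (\<forall>p \<in> X \<times> X. R p = canonical_map dot ast p))}"

text \<open>The bound \<open>d \<le> |\<int>/m|\<close> is void for \<open>m = 0\<close>.\<close>

definition parameters :: "(nat \<times> nat \<times> nat) set" where
  "parameters = {(m, n, d). 0 < n \<and> 0 < d \<and> (m = 0 \<or> d \<le> m)}"

text \<open>The solution with parameter \<open>(m, n, d)\<close> lives on \<open>\<int>/m \<times> {0, \<dots>, n - 1}\<close>, where \<open>\<int>/m\<close> is
  represented by the remainders modulo \<open>m\<close> (all of \<open>\<int>\<close> for \<open>m = 0\<close>, as \<open>a mod 0 = a\<close>). The maps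
  \<open>f\<close>, \<open>g\<close> below are commuting permutations with \<open>f ^ m = id\<close> and \<open>g ^ n = f ^ (- d)\<close>: this is the
  regular action of \<open>\<int>\<^sup>2 / \<langle>(m, 0), (d, n)\<rangle>\<close>. The sign of \<open>d\<close> matters for \<open>m = 0\<close>: with
  \<open>g ^ n = f ^ d\<close>, the upward closed sets would be proper subsets stable under \<open>f\<close> and \<open>g\<close>.\<close>

definition model_carrier :: "nat \<Rightarrow> nat \<Rightarrow> (int \<times> nat) set" where
  "model_carrier m n = range (\<lambda>a. a mod int m) \<times> {..<n}"

definition model_f :: "nat \<Rightarrow> int \<times> nat \<Rightarrow> int \<times> nat" where
  "model_f m = (\<lambda>(a, b). ((a + 1) mod int m, b))"

definition model_g :: "nat \<Rightarrow> nat \<Rightarrow> nat \<Rightarrow> int \<times> nat \<Rightarrow> int \<times> nat" where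
  "model_g m n d = (\<lambda>(a, b). if b + 1 < n then (a, b + 1) else ((a - int d) mod int m, 0))"

definition model :: "nat \<times> nat \<times> nat \<Rightarrow> (int \<times> nat) solution" where
  "model = (\<lambda>(m, n, d). (model_carrier m n, prod_map (model_f m) (model_g m n d)))"

end

theory Submission
  imports Defs "HOL-Library.Countable"
begin

text \<open>For an ideal-simple solution, the set of all \<open>y'\<close> that act in the same way as a given \<open>y\<close> is an
  ideal, so \<open>x \<cdot> y\<close> depends on \<open>x\<close> only and \<open>x \<star> y\<close> on \<open>y\<close> only. An incompressible commuting pair
  consists of permutations, since the inverses of \<open>f\<close> and \<open>g\<close> lie in the monoid that they generate;
  hence it is a transitive action of \<open>\<int>\<^sup>2\<close>, determined by the stabiliser \<open>L\<close> of a point, i.e. the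
  set of \<open>(a, b)\<close> such that \<open>f\<^sup>a g\<^sup>b\<close> fixes it.
  The monoid \<open>\<nat>\<^sup>2\<close> acts transitively iff \<open>L\<close> contains a vector with two positive entries,
  and the Hermite normal
  form of such an \<open>L\<close> is a basis \<open>(m, 0)\<close>, \<open>(d, n)\<close> with \<open>n, d > 0\<close> and \<open>d \<le> m\<close> unless \<open>m = 0\<close>.\<close>

section \<open>Incompressible pairs\<close>

locale incompressible_pair =
  fixes X :: "'a set" and f g :: "'a \<Rightarrow> 'a"
  assumes nonempty: "X \<noteq> {}"
    and f_closed: "x \<in> X \<Longrightarrow> f x \<in> X"
    and g_closed: "x \<in> X \<Longrightarrow> g x \<in> X"
    and commute: "x \<in> X \<Longrightarrow> f (g x) = g (f x)"
    and incompressible: "incompressible X {f, g}"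
begin

lemma stable_eq:
  assumes "I \<noteq> {}" "I \<subseteq> X" "\<And>x. x \<in> I \<Longrightarrow> f x \<in> I" "\<And>x. x \<in> I \<Longrightarrow> g x \<in> I"
  shows "I = X"
  using incompressible assms unfolding incompressible_def by blast

lemma f_funpow_closed: "x \<in> X \<Longrightarrow> (f ^^ i) x \<in> X"
  by (induction i) (auto intro: f_closed)

lemma g_funpow_closed: "x \<in> X \<Longrightarrow> (g ^^ i) x \<in> X"
  by (induction i) (auto intro: g_closed)

lemma f_funpow_commute: "x \<in> X \<Longrightarrow> (f ^^ i) (g x) = g ((f ^^ i) x)"
  by (induction i) (auto simp: commute f_funpow_closed)

lemma g_funpow_commute: "x \<in> X \<Longrightarrow> (g ^^ j) (f x) = f ((g ^^ j) x)"
  by (induction j) (auto simp: commute g_funpow_closed)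

lemma monoid_transitive:
  assumes "x \<in> X" "y \<in> X"
  obtains i j where "(f ^^ i) ((g ^^ j) x) = y"
proof -
  have "{(f ^^ i) ((g ^^ j) x) |i j. True} = X"
  proof (rule stable_eq)
    fix z assume "z \<in> {(f ^^ i) ((g ^^ j) x) |i j. True}"
    then obtain i j where z: "z = (f ^^ i) ((g ^^ j) x)" by blast
    have "f z = (f ^^ Suc i) ((g ^^ j) x)" by (simp add: z)
    then show "f z \<in> {(f ^^ i) ((g ^^ j) x) |i j. True}" by blast
    have "g z = (f ^^ i) ((g ^^ Suc j) x)"
      using assms by (simp add: z f_funpow_commute g_funpow_closed)
    then show "g z \<in> {(f ^^ i) ((g ^^ j) x) |i j. True}" by blast
  qed (use assms in \<open>auto intro: f_funpow_closed g_funpow_closed\<close>)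
  then show ?thesis using that assms by blast
qed

lemma swap: "incompressible_pair X g f"
  using nonempty f_closed g_closed commute incompressible
  by unfold_locales (auto simp: insert_commute)

lemma bij_f: "bij_betw f X X"
proof -
  obtain x where x: "x \<in> X" using nonempty by blast
  obtain i j where ij: "(f ^^ i) ((g ^^ j) (f x)) = x"
    using monoid_transitive x f_closed by metis
  have inv: "(f ^^ i) ((g ^^ j) (f y)) = y" if "y \<in> X" for y
  proof -
    have "{y \<in> X. (f ^^ i) ((g ^^ j) (f y)) = y} = X"
    proof (rule stable_eq)
      fix y assume y: "y \<in> {y \<in> X. (f ^^ i) ((g ^^ j) (f y)) = y}"
      then have yX: "y \<in> X" and eq: "(f ^^ i) ((g ^^ j) (f y)) = y" by auto
      have "(f ^^ i) ((g ^^ j) (f (f y))) = f ((f ^^ i) ((g ^^ j) (f y)))"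
        using yX by (simp add: g_funpow_commute f_closed funpow_swap1)
      then show "f y \<in> {y \<in> X. (f ^^ i) ((g ^^ j) (f y)) = y}"
        using yX eq f_closed by simp
      have "(f ^^ i) ((g ^^ j) (f (g y))) = (f ^^ i) (g ((g ^^ j) (f y)))"
        using yX by (simp add: commute funpow_swap1)
      also have "\<dots> = g ((f ^^ i) ((g ^^ j) (f y)))"
        using yX by (simp add: f_funpow_commute f_closed g_funpow_closed)
      finally show "g y \<in> {y \<in> X. (f ^^ i) ((g ^^ j) (f y)) = y}"
        using yX eq g_closed by simp
    qed (use x ij in auto)
    then show ?thesis using that by blast
  qed
  have "f ` X = X"
    by (rule stable_eq) (use nonempty in \<open>auto simp: f_closed g_closed simp flip: commute\<close>)
  moreover have "inj_on f X"
    by (rule inj_on_inverseI[where g = "\<lambda>y. (f ^^ i) ((g ^^ j) y)"]) (rule inv)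
  ultimately show ?thesis by (simp add: bij_betw_def)
qed

lemma bij_g: "bij_betw g X X"
  by (rule incompressible_pair.bij_f[OF swap])

lemma f_eq_iff: "x \<in> X \<Longrightarrow> y \<in> X \<Longrightarrow> f x = f y \<longleftrightarrow> x = y"
  using bij_f by (auto simp: bij_betw_def inj_on_def)

lemma g_funpow_eq_iff: "x \<in> X \<Longrightarrow> y \<in> X \<Longrightarrow> (g ^^ j) x = (g ^^ j) y \<longleftrightarrow> x = y"
  using bij_betw_funpow[OF bij_g, of j] by (auto simp: bij_betw_def inj_on_def)

definition fpow :: "int \<Rightarrow> 'a \<Rightarrow> 'a" where
  "fpow k = (if 0 \<le> k then f ^^ nat k else inv_into X f ^^ nat (- k))"

lemma fpow_of_nat: "fpow (int i) = f ^^ i"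
  by (simp add: fpow_def)

lemma fpow_0: "fpow 0 x = x"
  by (simp add: fpow_def)

lemma fpow_closed: "x \<in> X \<Longrightarrow> fpow k x \<in> X"
  unfolding fpow_def
  by (auto intro: bij_betw_apply bij_betw_funpow bij_f bij_betw_inv_into)

lemma fpow_plus_one:
  assumes "x \<in> X"
  shows "fpow (k + 1) x = f (fpow k x)"
proof (cases "0 \<le> k")
  case True
  then show ?thesis by (simp add: fpow_def nat_add_distrib)
next
  case False
  define n where "n = nat (- k - 1)"
  have k: "k = - int (Suc n)" using False by (simp add: n_def)
  have "(inv_into X f ^^ n) x \<in> X"
    using assms bij_betw_funpow[OF bij_betw_inv_into[OF bij_f], of n] by (auto simp: bij_betw_def)
  then have "f ((inv_into X f ^^ Suc n) x) = (inv_into X f ^^ n) x"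
    using bij_f by (simp add: bij_betw_def f_inv_into_f)
  moreover have "fpow (k + 1) x = (inv_into X f ^^ n) x"
    by (cases n) (auto simp: k fpow_def nat_add_distrib)
  moreover have "fpow k x = (inv_into X f ^^ Suc n) x"
    unfolding k fpow_def by (simp only: minus_minus nat_int) simp
  ultimately show ?thesis by simp
qed

lemma fpow_add:
  assumes "x \<in> X"
  shows "fpow (k + l) x = fpow k (fpow l x)"
proof (induction k rule: int_induct[where k = 0])
  case base
  show ?case by (simp add: fpow_0)
next
  case (step1 k)
  have "fpow (k + 1 + l) x = f (fpow (k + l) x)"
    using fpow_plus_one[OF assms, of "k + l"] by (simp add: algebra_simps)
  then show ?case using step1 assms by (simp add: fpow_plus_one fpow_closed)
next
  case (step2 k)
  have "f (fpow (k - 1 + l) x) = fpow (k + l) x"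
    using fpow_plus_one[OF assms, of "k - 1 + l"] by (simp add: algebra_simps)
  also have "\<dots> = f (fpow (k - 1) (fpow l x))"
    using step2 fpow_plus_one[OF fpow_closed[OF assms], of "k - 1" l] by simp
  finally show ?case using assms by (simp add: f_eq_iff fpow_closed)
qed

lemma g_fpow:
  assumes "x \<in> X"
  shows "g (fpow k x) = fpow k (g x)"
proof (induction k rule: int_induct[where k = 0])
  case base
  show ?case by (simp add: fpow_0)
next
  case (step1 k)
  then show ?case using assms by (simp add: fpow_plus_one fpow_closed g_closed flip: commute)
next
  case (step2 k)
  have "f (g (fpow (k - 1) x)) = g (fpow k x)"
    using assms fpow_plus_one[OF assms, of "k - 1"] by (simp add: commute fpow_closed)
  also have "\<dots> = f (fpow (k - 1) (g x))"
    using step2 assms fpow_plus_one[OF g_closed[OF assms], of "k - 1"] by simp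
  finally show ?case using assms by (simp add: f_eq_iff fpow_closed g_closed)
qed

lemma g_funpow_fpow: "x \<in> X \<Longrightarrow> (g ^^ j) (fpow k x) = fpow k ((g ^^ j) x)"
  by (induction j) (auto simp: g_fpow g_funpow_closed)

lemma fpow_eq_iff:
  assumes "x \<in> X" "y \<in> X"
  shows "fpow k x = fpow l y \<longleftrightarrow> y = fpow (k - l) x"
proof
  assume "fpow k x = fpow l y"
  then have "fpow (- l) (fpow k x) = fpow (- l) (fpow l y)" by simp
  then show "y = fpow (k - l) x"
    using fpow_add[of x "- l" k] fpow_add[of y "- l" l] assms by (simp add: fpow_0)
next
  assume "y = fpow (k - l) x"
  then show "fpow k x = fpow l y" using fpow_add[of x l "k - l"] assms by simp
qed

lemma period_exists:
  assumes "x \<in> X"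
  obtains m :: nat where "\<And>k. fpow k x = x \<longleftrightarrow> int m dvd k"
proof (cases "\<exists>k>0. fpow k x = x")
  case False
  have "fpow k x = x \<longleftrightarrow> k = 0" for k
  proof
    assume k: "fpow k x = x"
    then have "fpow (- k) x = x"
      using fpow_eq_iff[of x x 0 k] assms by (simp add: fpow_0)
    then show "k = 0" using k False by (metis neg_0_less_iff_less linorder_neqE)
  qed (simp add: fpow_0)
  then show ?thesis using that[of 0] by simp
next
  case True
  define P where "P = (\<lambda>i::nat. 0 < i \<and> fpow (int i) x = x)"
  define m where "m = (LEAST i. P i)"
  obtain k where "0 < k" "fpow k x = x" using True by blast
  then have "P (nat k)" by (simp add: P_def)
  then have Pm: "P m" unfolding m_def by (rule LeastI)
  have least: "\<not> P i" if "i < m" for i using that not_less_Least unfolding m_def by blast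
  have mult: "fpow (int m * int q) x = x" for q
  proof (induction q)
    case (Suc q)
    then show ?case
      using fpow_add[of x "int m" "int m * int q"] assms Pm by (simp add: P_def algebra_simps)
  qed (simp add: fpow_0)
  have multi: "fpow (int m * q) x = x" for q
  proof (cases "0 \<le> q")
    case True
    then show ?thesis using mult[of "nat q"] by simp
  next
    case False
    then have "fpow (- (int m * q)) x = x" using mult[of "nat (- q)"] by simp
    then show ?thesis using fpow_eq_iff[of x x 0 "- (int m * q)"] assms by (simp add: fpow_0)
  qed
  have "fpow k x = x \<longleftrightarrow> int m dvd k" for k
  proof
    assume k: "fpow k x = x"
    have "fpow (k mod int m) (fpow (int m * (k div int m)) x) = fpow k x"
      using fpow_add[of x "k mod int m" "int m * (k div int m)"] assms by simp
    then have "fpow (k mod int m) x = x" using multi k by simp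
    moreover have "0 \<le> k mod int m" "k mod int m < int m" using Pm by (auto simp: P_def)
    ultimately have "k mod int m = 0"
      using least[of "nat (k mod int m)"] by (auto simp: P_def nat_less_iff)
    then show "int m dvd k" by auto
  qed (auto simp: multi)
  then show ?thesis using that by blast
qed

end

section \<open>Transport along bijections\<close>

lemma isomorphic_trans:
  assumes "isomorphic S T" "isomorphic T U" "snd S \<in> fst S \<times> fst S \<rightarrow> fst S \<times> fst S"
  shows "isomorphic S U"
proof -
  obtain \<sigma> where \<sigma>: "bij_betw \<sigma> (fst S) (fst T)"
    "\<forall>p \<in> fst S \<times> fst S. map_prod \<sigma> \<sigma> (snd S p) = snd T (map_prod \<sigma> \<sigma> p)"
    using assms(1) unfolding isomorphic_def by blast
  obtain \<tau> where \<tau>: "bij_betw \<tau> (fst T) (fst U)"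
    "\<forall>p \<in> fst T \<times> fst T. map_prod \<tau> \<tau> (snd T p) = snd U (map_prod \<tau> \<tau> p)"
    using assms(2) unfolding isomorphic_def by blast
  have "map_prod (\<tau> \<circ> \<sigma>) (\<tau> \<circ> \<sigma>) (snd S p) = snd U (map_prod (\<tau> \<circ> \<sigma>) (\<tau> \<circ> \<sigma>) p)"
    if p: "p \<in> fst S \<times> fst S" for p
  proof -
    have "map_prod \<sigma> \<sigma> p \<in> fst T \<times> fst T"
      using p \<sigma>(1) by (auto intro: bij_betw_apply)
    then have "map_prod \<tau> \<tau> (map_prod \<sigma> \<sigma> (snd S p)) = snd U (map_prod \<tau> \<tau> (map_prod \<sigma> \<sigma> p))"
      using \<sigma>(2) \<tau>(2) p by metis
    then show ?thesis by (simp add: map_prod.compositionality)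
  qed
  then show ?thesis
    using bij_betw_trans[OF \<sigma>(1) \<tau>(1)] unfolding isomorphic_def by blast
qed

lemma isomorphic_sym:
  assumes "isomorphic S T" "snd S \<in> fst S \<times> fst S \<rightarrow> fst S \<times> fst S"
  shows "isomorphic T S"
proof -
  obtain \<sigma> where \<sigma>: "bij_betw \<sigma> (fst S) (fst T)"
    and hom: "\<forall>p \<in> fst S \<times> fst S. map_prod \<sigma> \<sigma> (snd S p) = snd T (map_prod \<sigma> \<sigma> p)"
    using assms(1) unfolding isomorphic_def by blast
  define \<tau> where "\<tau> = inv_into (fst S) \<sigma>"
  have \<tau>: "bij_betw \<tau> (fst T) (fst S)" unfolding \<tau>_def by (rule bij_betw_inv_into[OF \<sigma>])
  have \<tau>\<sigma>: "map_prod \<tau> \<tau> (map_prod \<sigma> \<sigma> p) = p" if "p \<in> fst S \<times> fst S" for p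
    using that \<sigma> by (auto simp: \<tau>_def bij_betw_def)
  have "map_prod \<tau> \<tau> (snd T q) = snd S (map_prod \<tau> \<tau> q)" if "q \<in> fst T \<times> fst T" for q
  proof -
    define p where "p = map_prod \<tau> \<tau> q"
    have p: "p \<in> fst S \<times> fst S" using that \<tau> by (auto simp: p_def intro: bij_betw_apply)
    have q: "q = map_prod \<sigma> \<sigma> p"
      using that \<sigma> by (auto simp: p_def \<tau>_def bij_betw_def f_inv_into_f)
    have "map_prod \<tau> \<tau> (snd T q) = map_prod \<tau> \<tau> (map_prod \<sigma> \<sigma> (snd S p))"
      unfolding q using bspec[OF hom p] by simp
    also have "\<dots> = snd S p" using \<tau>\<sigma> assms(2) p by blast
    finally show ?thesis by (simp add: p_def)
  qed
  then show ?thesis using \<tau> unfolding isomorphic_def by blast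
qed

lemma isomorphic_prod_mapI:
  assumes "bij_betw \<sigma> X Y" "\<And>x. x \<in> X \<Longrightarrow> \<sigma> (f x) = f' (\<sigma> x)" "\<And>x. x \<in> X \<Longrightarrow> \<sigma> (g x) = g' (\<sigma> x)"
  shows "isomorphic (X, prod_map f g) (Y, prod_map f' g')"
  using assms unfolding isomorphic_def prod_map_def by auto

lemma isomorphic_prod_mapE:
  assumes "isomorphic (X, prod_map f g) (Y, prod_map f' g')"
  obtains \<sigma> where "bij_betw \<sigma> X Y" "\<forall>x\<in>X. \<sigma> (f x) = f' (\<sigma> x)" "\<forall>x\<in>X. \<sigma> (g x) = g' (\<sigma> x)"
proof -
  obtain \<sigma> where \<sigma>: "bij_betw \<sigma> X Y"
    and hom: "\<forall>p \<in> X \<times> X. map_prod \<sigma> \<sigma> (prod_map f g p) = prod_map f' g' (map_prod \<sigma> \<sigma> p)"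
    using assms unfolding isomorphic_def by auto
  have "\<sigma> (f x) = f' (\<sigma> x)" "\<sigma> (g x) = g' (\<sigma> x)" if "x \<in> X" for x
    using bspec[OF hom, of "(x, x)"] that by (simp_all add: prod_map_def)
  then show ?thesis using that \<sigma> by blast
qed

lemma (in incompressible_pair) transport:
  assumes \<sigma>: "bij_betw \<sigma> X Y"
  obtains f' g' where "incompressible_pair Y f' g'"
    "isomorphic (Y, prod_map f' g') (X, prod_map f g)"
proof -
  define \<tau> where "\<tau> = inv_into X \<sigma>"
  have \<tau>: "bij_betw \<tau> Y X" unfolding \<tau>_def by (rule bij_betw_inv_into[OF \<sigma>])
  have \<tau>\<sigma>: "\<tau> (\<sigma> x) = x" if "x \<in> X" for x using that \<sigma> by (auto simp: \<tau>_def bij_betw_def)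
  have \<sigma>\<tau>: "\<sigma> (\<tau> y) = y" if "y \<in> Y" for y
    using that \<sigma> by (auto simp: \<tau>_def bij_betw_def f_inv_into_f)
  have \<tau>X: "\<tau> y \<in> X" if "y \<in> Y" for y using that \<tau> by (auto simp: bij_betw_def)
  have \<sigma>Y: "\<sigma> x \<in> Y" if "x \<in> X" for x using that \<sigma> by (auto simp: bij_betw_def)
  have "I = Y" if I: "I \<noteq> {}" "I \<subseteq> Y" "(\<lambda>y. \<sigma> (f (\<tau> y))) ` I \<subseteq> I" "(\<lambda>y. \<sigma> (g (\<tau> y))) ` I \<subseteq> I" for I
  proof -
    have "\<tau> ` I = X"
    proof (rule stable_eq)
      fix x assume "x \<in> \<tau> ` I"
      then obtain y where y: "y \<in> I" "x = \<tau> y" by blast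
      have "f x = \<tau> (\<sigma> (f (\<tau> y)))" "g x = \<tau> (\<sigma> (g (\<tau> y)))"
        using y I(2) \<tau>\<sigma> \<tau>X f_closed g_closed by (metis subsetD)+
      then show "f x \<in> \<tau> ` I" "g x \<in> \<tau> ` I" using I y by blast+
    qed (use I \<tau>X in auto)
    then show "I = Y" using \<tau> I(2) by (metis bij_betw_def inj_on_image_eq_iff order_refl)
  qed
  note stable = this
  have "incompressible Y {\<lambda>y. \<sigma> (f (\<tau> y)), \<lambda>y. \<sigma> (g (\<tau> y))}"
    unfolding incompressible_def
  proof (intro notI, elim exE conjE)
    fix I assume I: "I \<noteq> {}" "I \<subset> Y" "\<forall>h \<in> {\<lambda>y. \<sigma> (f (\<tau> y)), \<lambda>y. \<sigma> (g (\<tau> y))}. h ` I \<subseteq> I"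
    then have "I = Y" by (intro stable) simp_all
    then show False using I(2) by simp
  qed
  moreover have "Y \<noteq> {}" using nonempty \<sigma>Y by blast
  ultimately have "incompressible_pair Y (\<lambda>y. \<sigma> (f (\<tau> y))) (\<lambda>y. \<sigma> (g (\<tau> y)))"
    using \<open>Y \<noteq> {}\<close> by unfold_locales (auto simp: \<tau>\<sigma> \<tau>X \<sigma>Y f_closed g_closed commute)
  moreover have "isomorphic (Y, prod_map (\<lambda>y. \<sigma> (f (\<tau> y))) (\<lambda>y. \<sigma> (g (\<tau> y)))) (X, prod_map f g)"
    by (rule isomorphic_prod_mapI[OF \<tau>]) (auto simp: \<tau>\<sigma> \<tau>X f_closed g_closed)
  ultimately show ?thesis by (rule that)
qed

section \<open>Ideal-simple canonical solutions\<close>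

lemma ideal_simple_cong:
  assumes "\<And>p. p \<in> X \<times> X \<Longrightarrow> R p = R' p"
  shows "ideal_simple X R \<longleftrightarrow> ideal_simple X R'"
proof -
  have "is_ideal X R I \<longleftrightarrow> is_ideal X R' I" for I
  proof (cases "I \<subseteq> X")
    case True
    then have "R ` (I \<times> X) = R' ` (I \<times> X)" "R ` (X \<times> I) = R' ` (X \<times> I)"
      by (auto intro!: image_cong assms)
    then show ?thesis by (simp add: is_ideal_def)
  qed (simp add: is_ideal_def)
  then show ?thesis by (simp add: ideal_simple_def)
qed

lemma ideal_simple_iff_unique:
  "ideal_simple X R \<longleftrightarrow> is_ideal X R X \<and> (\<forall>I. is_ideal X R I \<longrightarrow> I = X)"
proof -
  have "{I. P I} = {X} \<longleftrightarrow> P X \<and> (\<forall>I. P I \<longrightarrow> I = X)" for P :: "'a set \<Rightarrow> bool"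
    by blast
  then show ?thesis by (simp add: ideal_simple_def)
qed

lemma is_ideal_prod_map:
  assumes "X \<noteq> {}" "f \<in> X \<rightarrow> X" "g \<in> X \<rightarrow> X"
  shows "is_ideal X (prod_map f g) I \<longleftrightarrow> I \<noteq> {} \<and> I \<subseteq> X \<and> f ` I \<subseteq> I \<and> g ` I \<subseteq> I"
proof -
  have "prod_map f g ` (A \<times> B) = f ` A \<times> g ` B" for A B
    by (auto simp: prod_map_def)
  then show ?thesis
    using assms by (auto simp: is_ideal_def times_subset_iff)
qed

lemma ideal_simple_prod_map:
  assumes "X \<noteq> {}" "f \<in> X \<rightarrow> X" "g \<in> X \<rightarrow> X"
  shows "ideal_simple X (prod_map f g) \<longleftrightarrow> incompressible X {f, g}"
proof -
  have "is_ideal X (prod_map f g) X"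
    using assms by (auto simp: is_ideal_prod_map)
  then have "ideal_simple X (prod_map f g) \<longleftrightarrow> (\<forall>I. is_ideal X (prod_map f g) I \<longrightarrow> I = X)"
    by (simp add: ideal_simple_iff_unique)
  moreover have "(\<forall>h\<in>{f, g}. h ` I \<subseteq> I) \<longleftrightarrow> f ` I \<subseteq> I \<and> g ` I \<subseteq> I" for I
    by simp
  ultimately show ?thesis
    unfolding is_ideal_prod_map[OF assms] incompressible_def psubset_eq by metis
qed

lemma (in plonka_bimagma) ideal_simple_imp_product:
  assumes simple: "ideal_simple X (canonical_map dot ast)" and y: "y \<in> X"
    and p: "p \<in> X \<times> X"
  shows "canonical_map dot ast p = prod_map (\<lambda>x. x \<cdot> y) (\<lambda>x. y \<star> x) p"
proof -
  have "is_ideal X (canonical_map dot ast) {z \<in> X. \<forall>x\<in>X. x \<cdot> z = x \<cdot> y}"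
    unfolding is_ideal_def canonical_map_def using y
    by (auto simp: dot_closed ast_closed dot_absorb ast_dot_absorb)
  moreover have "is_ideal X (canonical_map dot ast) {z \<in> X. \<forall>x\<in>X. z \<star> x = y \<star> x}"
    unfolding is_ideal_def canonical_map_def using y
    by (auto simp: dot_closed ast_closed ast_absorb dot_ast_absorb)
  ultimately have "{z \<in> X. \<forall>x\<in>X. x \<cdot> z = x \<cdot> y} = X" "{z \<in> X. \<forall>x\<in>X. z \<star> x = y \<star> x} = X"
    using simple unfolding ideal_simple_iff_unique by simp_all
  then show ?thesis using p unfolding canonical_map_def prod_map_def by auto
qed

lemma (in plonka_bimagma) ideal_simple_iff:
  assumes "X \<noteq> {}"
  shows "ideal_simple X (canonical_map dot ast) \<longleftrightarrow>
    (\<exists>f g. f \<in> X \<rightarrow> X \<and> g \<in> X \<rightarrow> X \<and> (\<forall>x \<in> X. f (g x) = g (f x)) \<and>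
       incompressible X {f, g} \<and> (\<forall>p \<in> X \<times> X. canonical_map dot ast p = prod_map f g p))"
    (is "?L \<longleftrightarrow> ?R")
proof
  assume simple: ?L
  obtain y where y: "y \<in> X" using assms by blast
  define f g where "f = (\<lambda>x. x \<cdot> y)" and "g = (\<lambda>x. y \<star> x)"
  have closed: "f \<in> X \<rightarrow> X" "g \<in> X \<rightarrow> X"
    using y by (auto simp: f_def g_def dot_closed ast_closed)
  have eq: "canonical_map dot ast p = prod_map f g p" if "p \<in> X \<times> X" for p
    unfolding f_def g_def by (rule ideal_simple_imp_product[OF simple y that])
  have "incompressible X {f, g}"
    using simple ideal_simple_cong[OF eq] ideal_simple_prod_map[OF assms closed] by simp
  moreover have "\<forall>x\<in>X. f (g x) = g (f x)" using y by (simp add: f_def g_def ast_dot)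
  ultimately show ?R using closed eq by blast
next
  assume ?R
  then obtain f g where closed: "f \<in> X \<rightarrow> X" "g \<in> X \<rightarrow> X" and inc: "incompressible X {f, g}"
    and eq: "\<forall>p \<in> X \<times> X. canonical_map dot ast p = prod_map f g p" by blast
  have "ideal_simple X (canonical_map dot ast) \<longleftrightarrow> ideal_simple X (prod_map f g)"
    by (rule ideal_simple_cong) (use eq in blast)
  then show ?L using ideal_simple_prod_map[OF assms closed] inc by simp
qed

lemma (in incompressible_pair) simple_canonical_solution:
  "(X, prod_map f g) \<in> simple_canonical_solutions"
proof -
  interpret B: plonka_bimagma X "\<lambda>x y. f x" "\<lambda>x y. g y"
    by unfold_locales (auto simp: f_closed g_closed commute)
  have "canonical_map (\<lambda>x y. f x) (\<lambda>x y. g y) = prod_map f g"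
    by (simp add: canonical_map_def prod_map_def)
  then have "YB_solution X (prod_map f g)"
    "\<forall>p \<in> X \<times> X. prod_map f g p = canonical_map (\<lambda>x y. f x) (\<lambda>x y. g y) p"
    using B.canonical_map_YB_solution by simp_all
  moreover have "ideal_simple X (prod_map f g)"
    using ideal_simple_prod_map[OF nonempty] f_closed g_closed incompressible by auto
  ultimately show ?thesis
    unfolding simple_canonical_solutions_def using B.plonka_bimagma_axioms by blast
qed

lemma simple_canonical_solutionE:
  assumes "S \<in> simple_canonical_solutions"
  obtains X f g where "fst S = X" "incompressible_pair X f g"
    "\<And>p. p \<in> X \<times> X \<Longrightarrow> snd S p = prod_map f g p"
proof -
  obtain X R dot ast where S: "S = (X, R)" and simple: "ideal_simple X R"
    and B: "plonka_bimagma X dot ast" and eq: "\<forall>p \<in> X \<times> X. R p = canonical_map dot ast p"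
    using assms unfolding simple_canonical_solutions_def by blast
  interpret plonka_bimagma X dot ast by (rule B)
  have "is_ideal X R X" using simple by (simp add: ideal_simple_iff_unique)
  then have ne: "X \<noteq> {}" by (simp add: is_ideal_def)
  have "ideal_simple X R \<longleftrightarrow> ideal_simple X (canonical_map dot ast)"
    by (rule ideal_simple_cong) (use eq in blast)
  then obtain f g where fg: "f \<in> X \<rightarrow> X" "g \<in> X \<rightarrow> X" "\<forall>x \<in> X. f (g x) = g (f x)"
    "incompressible X {f, g}" "\<forall>p \<in> X \<times> X. canonical_map dot ast p = prod_map f g p"
    using simple ideal_simple_iff[OF ne] by blast
  have "incompressible_pair X f g" using ne fg by unfold_locales auto
  then show ?thesis using that[of X f g] S eq fg(5) by simp
qed

lemma simple_canonical_closed: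
  "S \<in> simple_canonical_solutions \<Longrightarrow> snd S \<in> fst S \<times> fst S \<rightarrow> fst S \<times> fst S"
  by (cases S) (simp add: simple_canonical_solutions_def YB_solution_def)

section \<open>The models\<close>

lemma model_carrier_iff:
  "(a, b) \<in> model_carrier m n \<longleftrightarrow> a mod int m = a \<and> b < n"
  unfolding model_carrier_def by (auto simp: image_iff) (metis mod_mod_trivial)

lemma model_f_funpow:
  "a mod int m = a \<Longrightarrow> (model_f m ^^ i) (a, b) = ((a + int i) mod int m, b)"
  by (induction i) (auto simp: model_f_def mod_simps algebra_simps)

lemma model_g_funpow:
  assumes "a mod int m = a" "b < n"
  shows "(model_g m n d ^^ j) (a, b) = ((a - int d * int ((b + j) div n)) mod int m, (b + j) mod n)"
proof (induction j)
  case 0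
  then show ?case using assms by simp
next
  case (Suc j)
  show ?case
  proof (cases "Suc ((b + j) mod n) = n")
    case True
    then show ?thesis using Suc
      by (simp add: model_g_def div_Suc mod_Suc mod_simps algebra_simps)
  next
    case False
    moreover have "(b + j) mod n < n" using assms by simp
    ultimately have "Suc ((b + j) mod n) < n" by linarith
    then show ?thesis using Suc False
      by (simp add: model_g_def div_Suc mod_Suc mod_simps)
  qed
qed

lemma model_stabiliser:
  assumes "p \<in> model_carrier m n"
  shows "(model_f m ^^ i) ((model_g m n d ^^ j) p) = p \<longleftrightarrow>
    n dvd j \<and> int m dvd int i - int d * int (j div n)"
proof -
  obtain a b where p: "p = (a, b)" by (cases p)
  have ab: "a mod int m = a" "b < n" using assms by (simp_all add: p model_carrier_iff)
  have eq: "(model_f m ^^ i) ((model_g m n d ^^ j) p) =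
      ((a - int d * int ((b + j) div n) + int i) mod int m, (b + j) mod n)"
    by (simp add: p model_g_funpow[OF ab] model_f_funpow mod_simps)
  have b: "(b + j) mod n = b \<longleftrightarrow> n dvd j"
  proof -
    have "(b + j) mod n = b \<longleftrightarrow> (b + j) mod n = b mod n" using ab by simp
    also have "\<dots> \<longleftrightarrow> n dvd j" by (subst mod_eq_dvd_iff_nat) auto
    finally show ?thesis .
  qed
  have "(a - int d * int ((b + j) div n) + int i) mod int m = a \<longleftrightarrow>
      int m dvd int i - int d * int (j div n)" if "n dvd j"
  proof -
    have div: "(b + j) div n = j div n" using that ab by (auto elim!: dvdE)
    have "(a - int d * int ((b + j) div n) + int i) mod int m = a \<longleftrightarrow>
        (a - int d * int (j div n) + int i) mod int m = a mod int m"
      using ab div by simp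
    also have "\<dots> \<longleftrightarrow> int m dvd int i - int d * int (j div n)"
      by (subst mod_eq_dvd_iff) (simp add: algebra_simps)
    finally show ?thesis .
  qed
  then show ?thesis unfolding eq using b p by auto
qed

lemma model_f_closed: "p \<in> model_carrier m n \<Longrightarrow> model_f m p \<in> model_carrier m n"
  by (cases p) (auto simp: model_carrier_iff model_f_def)

lemma model_g_closed: "p \<in> model_carrier m n \<Longrightarrow> model_g m n d p \<in> model_carrier m n"
  by (cases p) (auto simp: model_carrier_iff model_g_def)

lemma model_incompressible_pair:
  assumes "(m, n, d) \<in> parameters"
  shows "incompressible_pair (model_carrier m n) (model_f m) (model_g m n d)"
proof
  have nd: "0 < n" "0 < d" using assms by (auto simp: parameters_def)
  then have "(0, 0) \<in> model_carrier m n" by (simp add: model_carrier_iff)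
  then show "model_carrier m n \<noteq> {}" by blast
  show "model_f m (model_g m n d p) = model_g m n d (model_f m p)" for p
    by (cases p) (auto simp: model_f_def model_g_def mod_simps algebra_simps)
  show "incompressible (model_carrier m n) {model_f m, model_g m n d}"
    unfolding incompressible_def
  proof (intro notI, elim exE conjE)
    fix I
    assume "I \<noteq> {}" "I \<subset> model_carrier m n" and stable: "\<forall>h \<in> {model_f m, model_g m n d}. h ` I \<subseteq> I"
    then obtain p q where p_in: "p \<in> I" and I: "I \<subseteq> model_carrier m n"
      and q: "q \<in> model_carrier m n" "q \<notin> I" by blast
    obtain a b where p: "p = (a, b)" by (cases p)
    obtain a' b' where q': "q = (a', b')" by (cases q)
    have ab: "a mod int m = a" "b < n" using I p_in by (auto simp: p model_carrier_iff)
    have ab': "a' mod int m = a'" "b' < n" using q by (simp_all add: q' model_carrier_iff)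
    have f_stable: "(model_f m ^^ i) x \<in> I" if "x \<in> I" for i x
      using that stable by (induction i) auto
    have g_stable: "(model_g m n d ^^ i) x \<in> I" if "x \<in> I" for i x
      using that stable by (induction i) auto
    \<comment> \<open>Going round the \<open>n\<close>-cycle often enough pushes the first coordinate below \<open>a'\<close>.\<close>
    define N where "N = Suc (nat (a - a'))"
    define j where "j = (n - b) + nat (a - a') * n + b'"
    define i where "i = nat (a' - (a - int d * int N))"
    have bj: "b + j = N * n + b'" using ab by (simp add: j_def N_def)
    have dj: "(b + j) div n = N" "(b + j) mod n = b'" using ab' unfolding bj by simp_all
    have "int N \<le> int d * int N" using nd by (simp add: mult_le_cancel_right1)
    moreover have "a - a' \<le> int N" by (simp add: N_def)
    ultimately have i: "int i = a' - (a - int d * int N)" by (simp add: i_def)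
    have "(model_f m ^^ i) ((model_g m n d ^^ j) p) = q"
      using ab' by (simp add: p q' model_g_funpow[OF ab] dj model_f_funpow mod_simps i)
    then show False using f_stable g_stable p_in q(2) by metis
  qed
qed (auto intro: model_f_closed model_g_closed)

lemma model_closed:
  "snd (model t) \<in> fst (model t) \<times> fst (model t) \<rightarrow> fst (model t) \<times> fst (model t)"
  by (cases t) (auto simp: model_def prod_map_def intro: model_f_closed model_g_closed)

lemma funpow_intertwine:
  assumes "\<forall>x\<in>X. \<sigma> (f x) = f' (\<sigma> x)" "\<forall>x\<in>X. f x \<in> X" "x \<in> X"
  shows "\<sigma> ((f ^^ i) x) = (f' ^^ i) (\<sigma> x) \<and> (f ^^ i) x \<in> X"
  using assms by (induction i) auto

lemma model_isomorphic_imp_eq: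
  assumes iso: "isomorphic (model t) (model t')" and t: "t \<in> parameters" "t' \<in> parameters"
  shows "t = t'"
proof -
  obtain m n d where mnd: "t = (m, n, d)" by (cases t)
  obtain m' n' d' where mnd': "t' = (m', n', d')" by (cases t')
  obtain \<sigma> where \<sigma>: "bij_betw \<sigma> (model_carrier m n) (model_carrier m' n')"
    and \<sigma>f: "\<forall>x \<in> model_carrier m n. \<sigma> (model_f m x) = model_f m' (\<sigma> x)"
    and \<sigma>g: "\<forall>x \<in> model_carrier m n. \<sigma> (model_g m n d x) = model_g m' n' d' (\<sigma> x)"
    using iso unfolding mnd mnd' model_def prod.case by (rule isomorphic_prod_mapE)
  have pos: "0 < n" "0 < d" "0 < n'" "0 < d'" and le: "m = 0 \<or> d \<le> m" "m' = 0 \<or> d' \<le> m'"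
    using t by (auto simp: mnd mnd' parameters_def)
  define p where "p = (0 :: int, 0 :: nat)"
  have p: "p \<in> model_carrier m n" using pos by (simp add: p_def model_carrier_iff)
  have p': "\<sigma> p \<in> model_carrier m' n'" using \<sigma> p by (auto simp: bij_betw_def)
  have stab: "n dvd j \<and> int m dvd int i - int d * int (j div n) \<longleftrightarrow>
      n' dvd j \<and> int m' dvd int i - int d' * int (j div n')" for i j
  proof -
    have gj: "\<sigma> ((model_g m n d ^^ j) p) = (model_g m' n' d' ^^ j) (\<sigma> p)"
      "(model_g m n d ^^ j) p \<in> model_carrier m n"
      using funpow_intertwine[OF \<sigma>g ballI[OF model_g_closed] p, of j] by auto
    have fi: "\<sigma> ((model_f m ^^ i) ((model_g m n d ^^ j) p)) =
        (model_f m' ^^ i) ((model_g m' n' d' ^^ j) (\<sigma> p))"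
      "(model_f m ^^ i) ((model_g m n d ^^ j) p) \<in> model_carrier m n"
      using funpow_intertwine[OF \<sigma>f ballI[OF model_f_closed] gj(2), of i] gj(1) by auto
    have "(model_f m ^^ i) ((model_g m n d ^^ j) p) = p \<longleftrightarrow>
        \<sigma> ((model_f m ^^ i) ((model_g m n d ^^ j) p)) = \<sigma> p"
      using \<sigma> fi(2) p by (auto simp: bij_betw_def inj_on_def)
    then show ?thesis
      unfolding fi(1) model_stabiliser[OF p] model_stabiliser[OF p'] .
  qed
  have "m dvd i \<longleftrightarrow> m' dvd i" for i using stab[of 0 i] by simp
  then have m: "m = m'" by (metis dvd_antisym dvd_refl)
  have dn: "n' dvd n \<and> int m' dvd int d - int d' * int (n div n')" using stab[of n d] pos by simp
  moreover have "n dvd n'" using stab[of n' d'] pos by simp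
  ultimately have n: "n = n'" by (simp add: dvd_antisym)
  then have dvd: "int m dvd int d - int d'" using dn pos m by simp
  have "d = d'"
  proof (cases "m = 0")
    case False
    then have "\<bar>int d - int d'\<bar> < int m" using le pos m by auto
    then show ?thesis using dvd zdvd_not_zless[of "\<bar>int d - int d'\<bar>" "int m"] by fastforce
  qed (use dvd in simp)
  then show ?thesis using m n by (simp add: mnd mnd')
qed

lemma (in incompressible_pair) isomorphic_model:
  obtains t where "t \<in> parameters" "isomorphic (X, prod_map f g) (model t)"
proof -
  obtain x where x: "x \<in> X" using nonempty by blast
  obtain m :: nat where m: "\<And>k. fpow k x = x \<longleftrightarrow> int m dvd k" using period_exists[OF x] by blast
  define P where "P = (\<lambda>j. 0 < j \<and> (\<exists>k. (g ^^ j) x = fpow k x))"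
  define n where "n = (LEAST j. P j)"
  obtain i j where "(f ^^ i) ((g ^^ j) (g x)) = x" using monoid_transitive x g_closed by metis
  then have "fpow (int i) ((g ^^ Suc j) x) = fpow 0 x"
    by (simp add: fpow_of_nat fpow_0 funpow_swap1)
  then have "x = fpow (int i - 0) ((g ^^ Suc j) x)" by (simp add: fpow_0)
  then have "(g ^^ Suc j) x = fpow (0 - int i) x"
    using fpow_eq_iff[of x "(g ^^ Suc j) x" 0 "int i"] x g_funpow_closed[OF x, of "Suc j"]
    by (simp add: fpow_0)
  then have "P (Suc j)" unfolding P_def by blast
  then have Pn: "P n" unfolding n_def by (rule LeastI)
  have least: "\<not> P j" if "j < n" for j using that not_less_Least unfolding n_def by blast
  have n: "0 < n" using Pn by (simp add: P_def)
  obtain e where e: "(g ^^ n) x = fpow e x" using Pn by (auto simp: P_def)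
  have gmult: "(g ^^ (q * n)) x = fpow (int q * e) x" for q
  proof (induction q)
    case (Suc q)
    have "(g ^^ (Suc q * n)) x = (g ^^ n) ((g ^^ (q * n)) x)" by (simp add: funpow_add)
    also have "\<dots> = fpow (int q * e) (fpow e x)"
      using Suc x by (simp add: g_funpow_fpow e)
    also have "\<dots> = fpow (int (Suc q) * e) x"
      using fpow_add[OF x, of "int q * e" e] by (simp add: algebra_simps)
    finally show ?case .
  qed (simp add: fpow_0)
  have e_neg: "e < 0" if "m = 0"
  proof -
    obtain i j where "(f ^^ i) ((g ^^ j) (f x)) = x" using monoid_transitive x f_closed by metis
    then have "fpow (int (Suc i)) ((g ^^ j) x) = fpow 0 x"
      using x unfolding fpow_of_nat by (simp add: fpow_0 g_funpow_commute funpow_swap1)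
    then have gj: "(g ^^ j) x = fpow (- int (Suc i)) x"
      using fpow_eq_iff[of x "(g ^^ j) x" 0 "int (Suc i)"] x g_funpow_closed[OF x, of j]
      by (simp add: fpow_0)
    define q r where "q = j div n" and "r = j mod n"
    have "j = r + q * n" by (simp add: q_def r_def)
    then have "(g ^^ j) x = (g ^^ r) ((g ^^ (q * n)) x)" by (simp add: funpow_add)
    also have "\<dots> = fpow (int q * e) ((g ^^ r) x)" using x by (simp add: gmult g_funpow_fpow)
    finally have gr: "fpow (int q * e) ((g ^^ r) x) = fpow (- int (Suc i)) x" using gj by simp
    then have "(g ^^ r) x = fpow (- int (Suc i) - int q * e) x"
      using fpow_eq_iff[of x "(g ^^ r) x" "- int (Suc i)" "int q * e"] x g_funpow_closed[OF x] by simp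
    moreover have "r < n" using n by (simp add: r_def)
    ultimately have "r = 0" using least[of r] unfolding P_def by auto
    then have "x = fpow (- int (Suc i) - int q * e) x"
      using \<open>(g ^^ r) x = fpow (- int (Suc i) - int q * e) x\<close> by simp
    then have "int q * e = - int (Suc i)" using m[of "- int (Suc i) - int q * e"] that by simp
    then show ?thesis by (smt (verit) mult_nonneg_nonneg of_nat_0_le_iff of_nat_Suc)
  qed
  define d where "d = (if m = 0 then nat (- e) else nat (int m - e mod int m))"
  have "0 < d" "m = 0 \<or> d \<le> m" and d: "int m dvd int d + e"
  proof -
    have "0 \<le> e mod int m \<and> e mod int m < int m" if "m \<noteq> 0" using that by simp
    then show "0 < d" "m = 0 \<or> d \<le> m" using e_neg by (auto simp: d_def nat_le_iff)
    show "int m dvd int d + e"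
    proof (cases "m = 0")
      case False
      then have "int d + e = int m + (e - e mod int m)"
        using pos_mod_bound[of "int m" e] by (simp add: d_def less_imp_le)
      then show ?thesis by (simp add: minus_mod_eq_mult_div)
    qed (use e_neg in \<open>simp add: d_def\<close>)
  qed
  then have par: "(m, n, d) \<in> parameters" using n by (simp add: parameters_def)
  define \<sigma> where "\<sigma> = (\<lambda>(a, b). fpow a ((g ^^ b) x))"
  have fpow_cong: "fpow k ((g ^^ b) x) = fpow l ((g ^^ b) x)" if "int m dvd k - l" for k l b
  proof -
    have "x = fpow (k - l) x" using m that by metis
    then have "fpow k x = fpow l x" using fpow_eq_iff[of x x k l] x by simp
    then show ?thesis using x by (simp flip: g_funpow_fpow)
  qed
  have \<sigma>X: "\<sigma> p \<in> X" for p by (cases p) (simp add: \<sigma>_def fpow_closed g_funpow_closed x)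
  have \<sigma>f: "\<sigma> (model_f m p) = f (\<sigma> p)" for p
  proof -
    obtain a b where p: "p = (a, b)" by (cases p)
    have "int m dvd (a + 1) mod int m - (a + 1)" by (simp add: mod_eq_dvd_iff[symmetric])
    then have "\<sigma> (model_f m p) = fpow (a + 1) ((g ^^ b) x)"
      using fpow_cong by (simp add: \<sigma>_def model_f_def p)
    then show ?thesis using x by (simp add: \<sigma>_def p fpow_plus_one g_funpow_closed)
  qed
  have \<sigma>g: "\<sigma> (model_g m n d p) = g (\<sigma> p)" if "p \<in> model_carrier m n" for p
  proof -
    obtain a b where p: "p = (a, b)" by (cases p)
    have "b < n" using that by (simp add: p model_carrier_iff)
    have g\<sigma>: "g (\<sigma> p) = fpow a ((g ^^ Suc b) x)"
      using x by (simp add: \<sigma>_def p g_fpow g_funpow_closed)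
    show ?thesis
    proof (cases "b + 1 < n")
      case True
      then show ?thesis using g\<sigma> by (simp add: p model_g_def \<sigma>_def)
    next
      case False
      then have "Suc b = n" using \<open>b < n\<close> by simp
      then have "g (\<sigma> p) = fpow (a + e) ((g ^^ 0) x)"
        unfolding g\<sigma> using e x fpow_add[OF x, of a e] by simp
      also have "\<dots> = fpow ((a - int d) mod int m) ((g ^^ 0) x)"
      proof (rule fpow_cong)
        have "int m dvd (a - int d) - (a - int d) mod int m"
          by (simp add: mod_eq_dvd_iff[symmetric])
        then have "int m dvd ((a - int d) - (a - int d) mod int m) + (int d + e)"
          using d by (rule dvd_add)
        then show "int m dvd a + e - (a - int d) mod int m" by (simp add: algebra_simps)
      qed
      finally show ?thesis using False by (simp add: p model_g_def \<sigma>_def)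
    qed
  qed
  have inj: "p = q" if pq: "p \<in> model_carrier m n" "q \<in> model_carrier m n" "\<sigma> p = \<sigma> q"
    "snd p \<le> snd q" for p q
  proof -
    obtain a b where p: "p = (a, b)" by (cases p)
    obtain a' b' where q: "q = (a', b')" by (cases q)
    have ab: "a mod int m = a" "b < n" "a' mod int m = a'" "b' < n" "b \<le> b'"
      using pq by (simp_all add: p q model_carrier_iff)
    define c where "c = b' - b"
    have b': "b' = b + c" using ab by (simp add: c_def)
    have "(g ^^ b) (fpow a x) = (g ^^ b) (fpow a' ((g ^^ c) x))"
      using pq(3) x by (simp add: \<sigma>_def p q b' funpow_add g_funpow_fpow g_funpow_closed)
    then have "fpow a x = fpow a' ((g ^^ c) x)"
      using x by (simp add: g_funpow_eq_iff fpow_closed g_funpow_closed)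
    then have gc: "(g ^^ c) x = fpow (a - a') x"
      using fpow_eq_iff[of x "(g ^^ c) x" a a'] x g_funpow_closed by simp
    then have c: "c = 0" using least[of c] ab unfolding P_def c_def by fastforce
    then have "int m dvd a - a'" using gc m[of "a - a'"] by simp
    then have "a = a'" using ab by (metis mod_eq_dvd_iff)
    then show "p = q" using c b' by (simp add: p q)
  qed
  have "inj_on \<sigma> (model_carrier m n)"
    by (rule inj_onI) (metis inj nat_le_linear)
  moreover have "\<sigma> ` model_carrier m n = X"
  proof (rule stable_eq)
    show "\<sigma> ` model_carrier m n \<noteq> {}"
      using incompressible_pair.nonempty[OF model_incompressible_pair[OF par]] by simp
    show "f y \<in> \<sigma> ` model_carrier m n" if "y \<in> \<sigma> ` model_carrier m n" for y
      using that by (auto simp flip: \<sigma>f intro: model_f_closed)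
    show "g y \<in> \<sigma> ` model_carrier m n" if "y \<in> \<sigma> ` model_carrier m n" for y
      using that by (auto simp flip: \<sigma>g intro: model_g_closed)
  qed (use \<sigma>X in auto)
  ultimately have "bij_betw \<sigma> (model_carrier m n) X" by (simp add: bij_betw_def)
  then have "isomorphic (model (m, n, d)) (X, prod_map f g)"
    unfolding model_def prod.case using \<sigma>f \<sigma>g by (intro isomorphic_prod_mapI) auto
  then show ?thesis using that par isomorphic_sym model_closed by blast
qed

section \<open>Isomorphism classes\<close>

lemma simple_canonical_isomorphic_model:
  assumes "S \<in> simple_canonical_solutions"
  obtains t where "t \<in> parameters" "isomorphic S (model t)"
proof -
  obtain X f g where S: "fst S = X" and pair: "incompressible_pair X f g"
    and eq: "\<And>p. p \<in> X \<times> X \<Longrightarrow> snd S p = prod_map f g p"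
    using assms by (rule simple_canonical_solutionE) blast
  obtain t where "t \<in> parameters" "isomorphic (X, prod_map f g) (model t)"
    using incompressible_pair.isomorphic_model[OF pair] by blast
  moreover have "isomorphic S (X, prod_map f g)"
    unfolding isomorphic_def by (rule exI[where x = id]) (use S eq in \<open>simp add: map_prod.id\<close>)
  ultimately show ?thesis using that isomorphic_trans simple_canonical_closed[OF assms] by blast
qed

lemma simple_canonical_model_copy:
  assumes "t \<in> parameters" "bij_betw \<sigma> (fst (model t)) Y"
  obtains S where "S \<in> simple_canonical_solutions" "fst S = Y" "isomorphic S (model t)"
proof -
  obtain m n d where t: "t = (m, n, d)" by (cases t)
  interpret M: incompressible_pair "model_carrier m n" "model_f m" "model_g m n d"
    by (rule model_incompressible_pair) (use assms t in simp)
  obtain f g where pair: "incompressible_pair Y f g"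
    and "isomorphic (Y, prod_map f g) (model_carrier m n, prod_map (model_f m) (model_g m n d))"
    using M.transport[of \<sigma> Y] assms(2) by (auto simp: t model_def)
  then show ?thesis
    using that[of "(Y, prod_map f g)"] incompressible_pair.simple_canonical_solution[OF pair]
    by (simp add: t model_def)
qed

lemma bij_betw_iso_classes:
  fixes A :: "'a solution set"
  assumes A: "A \<subseteq> simple_canonical_solutions" and P: "P \<subseteq> parameters"
    and realised: "\<And>t. t \<in> P \<Longrightarrow> \<exists>S\<in>A. isomorphic S (model t)"
    and covered: "\<And>S t. S \<in> A \<Longrightarrow> t \<in> parameters \<Longrightarrow> isomorphic S (model t) \<Longrightarrow> t \<in> P"
  shows "bij_betw (\<lambda>t. {S \<in> A. isomorphic S (model t)}) P (iso_classes A)"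
proof -
  define r where "r = {(S, S'). S \<in> A \<and> S' \<in> A \<and> isomorphic S S'}"
  have closed: "snd S \<in> fst S \<times> fst S \<rightarrow> fst S \<times> fst S" if "S \<in> A" for S
    using that A simple_canonical_closed by blast
  have "class": "r `` {S} = {S \<in> A. isomorphic S (model t)}"
    if "S \<in> A" "isomorphic S (model t)" for S t
  proof (intro set_eqI iffI)
    fix T assume "T \<in> r `` {S}"
    then have T: "T \<in> A" "isomorphic S T" by (simp_all add: r_def)
    have "isomorphic T S" by (rule isomorphic_sym[OF T(2) closed[OF that(1)]])
    then have "isomorphic T (model t)" by (rule isomorphic_trans[OF _ that(2) closed[OF T(1)]])
    then show "T \<in> {S \<in> A. isomorphic S (model t)}" using T by simp
  next
    fix T assume "T \<in> {S \<in> A. isomorphic S (model t)}"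
    then have T: "T \<in> A" "isomorphic T (model t)" by simp_all
    have "isomorphic (model t) T" by (rule isomorphic_sym[OF T(2) closed[OF T(1)]])
    then have "isomorphic S T" by (rule isomorphic_trans[OF that(2) _ closed[OF that(1)]])
    then show "T \<in> r `` {S}" using T that by (simp add: r_def)
  qed
  have "inj_on (\<lambda>t. {S \<in> A. isomorphic S (model t)}) P"
  proof (rule inj_onI)
    fix t t'
    assume t: "t \<in> P" "t' \<in> P"
      and eq: "{S \<in> A. isomorphic S (model t)} = {S \<in> A. isomorphic S (model t')}"
    obtain S where S: "S \<in> A" "isomorphic S (model t)" using realised[OF t(1)] by blast
    then have "isomorphic S (model t')" using eq by blast
    moreover have "isomorphic (model t) S" using S closed isomorphic_sym by blast
    ultimately have "isomorphic (model t) (model t')" using isomorphic_trans model_closed by blast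
    then show "t = t'" using model_isomorphic_imp_eq t P by blast
  qed
  moreover have "(\<lambda>t. {S \<in> A. isomorphic S (model t)}) ` P = A // r"
  proof (intro set_eqI iffI)
    fix C assume "C \<in> (\<lambda>t. {S \<in> A. isomorphic S (model t)}) ` P"
    then obtain t where t: "t \<in> P" "C = {S \<in> A. isomorphic S (model t)}" by blast
    obtain S where S: "S \<in> A" "isomorphic S (model t)" using realised[OF t(1)] by blast
    show "C \<in> A // r" using quotientI[OF S(1), of r] "class"[OF S] t(2) by simp
  next
    fix C assume "C \<in> A // r"
    then obtain S where S: "S \<in> A" "C = r `` {S}" by (rule quotientE)
    obtain t where t: "t \<in> parameters" "isomorphic S (model t)"
      using simple_canonical_isomorphic_model S(1) A by blast
    show "C \<in> (\<lambda>t. {S \<in> A. isomorphic S (model t)}) ` P"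
      using "class"[OF S(1) t(2)] covered[OF S(1) t] S(2) by blast
  qed
  ultimately show ?thesis by (simp add: bij_betw_def iso_classes_def r_def)
qed

lemma model_carrier_0: "model_carrier 0 n = UNIV \<times> {..<n}"
  by (auto simp: model_carrier_iff)

lemma model_carrier_pos: "0 < m \<Longrightarrow> model_carrier m n = {0..<int m} \<times> {..<n}"
proof -
  assume "0 < m"
  then have "a mod int m = a \<longleftrightarrow> 0 \<le> a \<and> a < int m" for a
    by (metis mod_pos_pos_trivial of_nat_0_less_iff pos_mod_bound pos_mod_sign)
  then have "(a, b) \<in> model_carrier m n \<longleftrightarrow> (a, b) \<in> {0..<int m} \<times> {..<n}" for a b
    by (simp add: model_carrier_iff)
  then show ?thesis by (metis set_eqI surj_pair)
qed

lemma finite_model_iff: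
  assumes "(m, n, d) \<in> parameters"
  shows "finite (fst (model (m, n, d))) \<and> card (fst (model (m, n, d))) = t \<longleftrightarrow> 0 < m \<and> m * n = t"
proof (cases "m = 0")
  case True
  have "{..<n} \<noteq> {}" using assms by (auto simp: parameters_def)
  then show ?thesis
    using True by (simp add: model_def model_carrier_0 finite_cartesian_product_iff infinite_UNIV_int)
qed (auto simp: model_def model_carrier_pos)

lemma card_parameters:
  assumes "0 < t"
  shows "card {(m, n, d). (m, n, d) \<in> parameters \<and> 0 < m \<and> m * n = t} = (\<Sum>k | k dvd t. k)"
proof -
  have "bij_betw (\<lambda>(m, d). (m, t div m, d)) (SIGMA m:{k. k dvd t}. {1..m})
      {(m, n, d). (m, n, d) \<in> parameters \<and> 0 < m \<and> m * n = t}"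
    by (rule bij_betw_byWitness[where f' = "\<lambda>(m, n, d). (m, d)"])
      (use assms in \<open>auto simp: parameters_def elim!: dvdE\<close>)
  then have "card {(m, n, d). (m, n, d) \<in> parameters \<and> 0 < m \<and> m * n = t} =
      card (SIGMA m:{k. k dvd t}. {1..m})"
    by (simp add: bij_betw_same_card)
  also have "\<dots> = (\<Sum>k | k dvd t. k)" using assms by simp
  finally show ?thesis .
qed

theorem theoremB:
  fixes X :: "'a set"
  assumes "X \<noteq> {}"
    and universe: "infinite (UNIV :: 'u set)"
  shows
    "(\<forall>dot ast. plonka_bimagma X dot ast \<longrightarrow>
        (ideal_simple X (canonical_map dot ast) \<longleftrightarrow>
         (\<exists>f g. f \<in> X \<rightarrow> X \<and> g \<in> X \<rightarrow> X \<and> (\<forall>x \<in> X. f (g x) = g (f x)) \<and>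
            incompressible X {f, g} \<and>
            (\<forall>p \<in> X \<times> X. canonical_map dot ast p = prod_map f g p)))) \<and>
     bij_betw (\<lambda>t. {S \<in> simple_canonical_solutions. isomorphic S (model t)})
        parameters (iso_classes (simple_canonical_solutions :: 'u solution set)) \<and>
     (\<forall>t. finite X \<and> card X = t \<longrightarrow>
        card (iso_classes {S \<in> simple_canonical_solutions. fst S = X}) = (\<Sum>k | k dvd t. k))"
proof (intro conjI allI impI)
  fix dot ast assume "plonka_bimagma X dot ast"
  then interpret plonka_bimagma X dot ast .
  show "ideal_simple X (canonical_map dot ast) \<longleftrightarrow>
         (\<exists>f g. f \<in> X \<rightarrow> X \<and> g \<in> X \<rightarrow> X \<and> (\<forall>x \<in> X. f (g x) = g (f x)) \<and>
            incompressible X {f, g} \<and>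
            (\<forall>p \<in> X \<times> X. canonical_map dot ast p = prod_map f g p))"
    by (rule ideal_simple_iff[OF assms(1)])
next
  obtain \<iota> :: "nat \<Rightarrow> 'u" where "inj \<iota>" using infinite_countable_subset[OF universe] by blast
  then have inj: "inj (\<iota> \<circ> to_nat :: int \<times> nat \<Rightarrow> 'u)" by (simp add: inj_compose)
  show "bij_betw (\<lambda>t. {S \<in> simple_canonical_solutions. isomorphic S (model t)})
        parameters (iso_classes (simple_canonical_solutions :: 'u solution set))"
  proof (rule bij_betw_iso_classes)
    fix t assume t: "t \<in> parameters"
    have "bij_betw (\<iota> \<circ> to_nat) (fst (model t)) ((\<iota> \<circ> to_nat) ` fst (model t))"
      using inj by (rule inj_on_imp_bij_betw[OF inj_on_subset]) simp
    with t obtain S :: "'u solution" where "S \<in> simple_canonical_solutions" "isomorphic S (model t)"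
      by (rule simple_canonical_model_copy)
    then show "\<exists>S \<in> simple_canonical_solutions :: 'u solution set. isomorphic S (model t)" by blast
  qed auto
next
  fix t assume t: "finite X \<and> card X = t"
  then have pos: "0 < t" using assms(1) by (auto simp: card_gt_0_iff)
  define P where "P = {(m, n, d). (m, n, d) \<in> parameters \<and> 0 < m \<and> m * n = t}"
  have P: "s \<in> P \<longleftrightarrow> s \<in> parameters \<and> finite (fst (model s)) \<and> card (fst (model s)) = t" for s
  proof -
    obtain m n d where s: "s = (m, n, d)" by (cases s)
    show ?thesis using finite_model_iff[of m n d t] by (auto simp: P_def s)
  qed
  have "bij_betw (\<lambda>t. {S \<in> {S \<in> simple_canonical_solutions. fst S = X}. isomorphic S (model t)})
      P (iso_classes {S \<in> simple_canonical_solutions. fst S = X})"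
  proof (rule bij_betw_iso_classes)
    fix s assume s: "s \<in> P"
    then obtain \<sigma> where "bij_betw \<sigma> (fst (model s)) X"
      using t P finite_same_card_bij by metis
    moreover have "s \<in> parameters" using s P by simp
    ultimately obtain S where "S \<in> simple_canonical_solutions" "fst S = X" "isomorphic S (model s)"
      using simple_canonical_model_copy by blast
    then show "\<exists>S \<in> {S \<in> simple_canonical_solutions. fst S = X}. isomorphic S (model s)" by blast
  next
    fix S s assume S: "S \<in> {S \<in> simple_canonical_solutions. fst S = X}"
      and s: "s \<in> parameters" "isomorphic S (model s)"
    obtain \<sigma> where "bij_betw \<sigma> X (fst (model s))"
      using s(2) S unfolding isomorphic_def by auto
    then show "s \<in> P" using t P s(1) bij_betw_finite bij_betw_same_card by metis
  qed (auto simp: P)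
  then have "card P = card (iso_classes {S \<in> simple_canonical_solutions. fst S = X})"
    by (rule bij_betw_same_card)
  then show "card (iso_classes {S \<in> simple_canonical_solutions. fst S = X}) = (\<Sum>k | k dvd t. k)"
    using card_parameters[OF pos] by (simp add: P_def)
qed

end
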